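(* Let $n\ge1$ be an integer (with $n\le N$ when $J=\{1,\dots,N\}$), and let $\alpha\in(0,1)$, $\beta\in(0,1-\alpha)$ be such that $\alpha+\beta\le0.59$. For $1\le k\le n$ let $$\mathcal{S}_{k,n}=\{\theta\in l_2(J):\ \theta_j=0\ \text{for all } j>n,\ \mathrm{Card}\{j\le n:\theta_j\ne0\}\le k\}.$$ Let $\sigma_{(1)}\le\dots\le\sigma_{(n)}$ be the values $\sigma_1,\dots,\sigma_n$ arranged in non-decreasing order, and define $$\rho_{n,\infty}=\max_{0\le l\le n-1}\sigma_{(l+1)}\sqrt{\ln(1+n-l)}.$$ Then for every $1\le k\le n$, $\ \rho_\infty(\mathcal{S}_{k,n},\alpha,\beta)\ge\rho_{n,\infty}$.
   Context: Model: $J=\{1,\dots,N\}$ for some integer $N\ge1$, or $J=\{1,2,3,\dots\}$. One observes $Y=(Y_j)_{j\in J}$ with $Y_j=\theta_j+\sigma_j\epsilon_j$, where $\theta=(\theta_j)_{j\in J}$ is unknown, $\sigma_j>0$ are known, and $(\epsilon_j)_{j\in J}$ are i.i.d. standard normal. $\mathbb{P}_\theta$ is the distribution of $Y$. $\|\theta\|_\infty=\sup_{j\in J}|\theta_j|$. A test is a measurable function $\Phi$ of $Y$ with values in $\{0,1\}$; the null hypothesis "$\theta=0$" is rejected iff $\Phi=1$. It has level $\alpha$ if $\mathbb{P}_0(\Phi=1)\le\alpha$. For $\mathcal{F}\subset l_\infty(J)$ and a level-$\alpha$ test $\Phi_\alpha$, $\rho_\infty(\Phi_\alpha,\mathcal{F},\beta)=\inf\{\rho>0:\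 \inf_{\theta\in\mathcal{F},\|\theta\|_\infty\ge\rho}\mathbb{P}_\theta(\Phi_\alpha=1)>1-\beta\}$, and the $(\alpha,\beta)$ minimax rate of testing with respect to the $l_\infty$ norm, $\rho_\infty(\mathcal{F},\alpha,\beta)$, is the infimum of $\rho_\infty(\Phi_\alpha,\mathcal{F},\beta)$ over all level-$\alpha$ tests $\Phi_\alpha$. *)

theory Defs
  imports "HOL-Probability.Probability"
begin

text \<open>
  Sequences indexed by \<open>J\<close> are functions on \<open>nat\<close> that are extensional on \<open>J\<close>, as for
  \<^const>\<open>PiM\<close>. Infima are taken in \<^typ>\<open>ereal\<close>, so that an infimum over the empty set is \<open>\<infinity>\<close>.
\<close>

definition l_two :: "nat set \<Rightarrow> (nat \<Rightarrow> real) set" where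
  "l_two J = {\<theta> \<in> J \<rightarrow>\<^sub>E UNIV. (\<lambda>j. (\<theta> j)\<^sup>2) summable_on J}"

definition l_infty :: "nat set \<Rightarrow> (nat \<Rightarrow> real) set" where
  "l_infty J = {\<theta> \<in> J \<rightarrow>\<^sub>E UNIV. bounded (\<theta> ` J)}"

text \<open>A real supremum: meaningful for nonempty \<open>J\<close> and \<open>\<theta> \<in> l_infty J\<close>.\<close>

definition sup_norm :: "nat set \<Rightarrow> (nat \<Rightarrow> real) \<Rightarrow> real" where
  "sup_norm J \<theta> = (SUP j\<in>J. \<bar>\<theta> j\<bar>)"

text \<open>The law of \<open>(\<theta>\<^sub>j + \<sigma>\<^sub>j \<epsilon>\<^sub>j)\<close> for \<open>j \<in> J\<close>, where \<open>\<epsilon>\<close> is i.i.d. standard normal.\<close>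

definition obs_law :: "nat set \<Rightarrow> (nat \<Rightarrow> real) \<Rightarrow> (nat \<Rightarrow> real) \<Rightarrow> (nat \<Rightarrow> real) measure" where
  "obs_law J \<sigma> \<theta> =
     distr (\<Pi>\<^sub>M j\<in>J. std_normal_distribution) (\<Pi>\<^sub>M j\<in>J. borel)
       (\<lambda>\<epsilon>. \<lambda>j\<in>J. \<theta> j + \<sigma> j * \<epsilon> j)"

lemma prob_space_obs_law: "prob_space (obs_law J \<sigma> \<theta>)"
proof -
  interpret S: prob_space std_normal_distribution
    by (simp add: prob_space_normal_density)
  interpret product_prob_space "\<lambda>_::nat. std_normal_distribution" J ..
  show ?thesis
    unfolding obs_law_def by (rule P.prob_space_distr) measurable
qed

definition tests :: "nat set \<Rightarrow> ((nat \<Rightarrow> real) \<Rightarrow> nat) set" where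
  "tests J = (\<Pi>\<^sub>M j\<in>J. borel) \<rightarrow>\<^sub>M count_space {0, 1}"

definition reject_prob ::
  "nat set \<Rightarrow> (nat \<Rightarrow> real) \<Rightarrow> (nat \<Rightarrow> real) \<Rightarrow> ((nat \<Rightarrow> real) \<Rightarrow> nat) \<Rightarrow> real" where
  "reject_prob J \<sigma> \<theta> \<Phi> =
     measure (obs_law J \<sigma> \<theta>) {y \<in> space (obs_law J \<sigma> \<theta>). \<Phi> y = 1}"

definition level_tests :: "nat set \<Rightarrow> (nat \<Rightarrow> real) \<Rightarrow> real \<Rightarrow> ((nat \<Rightarrow> real) \<Rightarrow> nat) set" where
  "level_tests J \<sigma> \<alpha> = {\<Phi> \<in> tests J. reject_prob J \<sigma> (\<lambda>j\<in>J. 0) \<Phi> \<le> \<alpha>}"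

definition rho_infty_test ::
  "nat set \<Rightarrow> (nat \<Rightarrow> real) \<Rightarrow> ((nat \<Rightarrow> real) \<Rightarrow> nat) \<Rightarrow> (nat \<Rightarrow> real) set \<Rightarrow> real \<Rightarrow> ereal" where
  "rho_infty_test J \<sigma> \<Phi> F \<beta> =
     Inf {ereal \<rho> | \<rho>. \<rho> > 0 \<and>
       (INF \<theta>\<in>{\<theta> \<in> F. sup_norm J \<theta> \<ge> \<rho>}. ereal (reject_prob J \<sigma> \<theta> \<Phi>)) > ereal (1 - \<beta>)}"

definition rho_infty ::
  "nat set \<Rightarrow> (nat \<Rightarrow> real) \<Rightarrow> (nat \<Rightarrow> real) set \<Rightarrow> real \<Rightarrow> real \<Rightarrow> ereal" where
  "rho_infty J \<sigma> F \<alpha> \<beta> = (INF \<Phi>\<in>level_tests J \<sigma> \<alpha>. rho_infty_test J \<sigma> \<Phi> F \<beta>)"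

definition sparse_set :: "nat set \<Rightarrow> nat \<Rightarrow> nat \<Rightarrow> (nat \<Rightarrow> real) set" where
  "sparse_set J k n =
     {\<theta> \<in> l_two J. (\<forall>j\<in>J. j > n \<longrightarrow> \<theta> j = 0) \<and> card {j\<in>J. j \<le> n \<and> \<theta> j \<noteq> 0} \<le> k}"

lemma sparse_set_subset_l_infty: "sparse_set J k n \<subseteq> l_infty J"
proof
  fix \<theta> assume "\<theta> \<in> sparse_set J k n"
  then have *: "\<theta> \<in> J \<rightarrow>\<^sub>E UNIV" "\<forall>j\<in>J. j > n \<longrightarrow> \<theta> j = 0"
    by (auto simp: sparse_set_def l_two_def)
  have "\<theta> ` J \<subseteq> insert 0 (\<theta> ` {..n})"
    using *(2) by (force simp: not_less)
  then have "finite (\<theta> ` J)"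
    by (rule finite_subset) simp
  then show "\<theta> \<in> l_infty J"
    using *(1) by (simp add: l_infty_def finite_imp_bounded)
qed

text \<open>\<open>order_stat \<sigma> n i\<close> is the \<open>i\<close>-th smallest of \<open>\<sigma> 1, \<dots>, \<sigma> n\<close>, for \<open>1 \<le> i \<le> n\<close>.\<close>

definition order_stat :: "(nat \<Rightarrow> real) \<Rightarrow> nat \<Rightarrow> nat \<Rightarrow> real" where
  "order_stat \<sigma> n i = sort (map \<sigma> [1..<n+1]) ! (i - 1)"

definition rho_n_infty :: "(nat \<Rightarrow> real) \<Rightarrow> nat \<Rightarrow> real" where
  "rho_n_infty \<sigma> n =
     (MAX l\<in>{0..n-1}. order_stat \<sigma> n (l + 1) * sqrt (ln (1 + real n - real l)))"

end

theory Submission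
  imports Defs
begin

text \<open>
  The bound is Bayesian: a test that is powerful against every alternative in a family is powerful on
  average over it, so it suffices to exhibit a prior on alternatives of norm \<open>r\<close> whose mixture is
  too close to the null law. Fix \<open>l\<close> and put \<open>m = n - l\<close>,
  \<open>r = \<sigma>\<^sub>(\<^sub>l\<^sub>+\<^sub>1\<^sub>) sqrt (ln (1 + m))\<close>. At least \<open>m\<close> of the indices \<open>j \<le> n\<close> satisfy
  \<open>\<sigma> j \<ge> \<sigma>\<^sub>(\<^sub>l\<^sub>+\<^sub>1\<^sub>)\<close>; call their set \<open>S\<close>. The prior chooses \<open>j \<in> S\<close> uniformly, then a fair sign,
  and sets \<open>\<theta> = \<plusminus> r e\<^sub>j\<close>; such a \<open>\<theta>\<close> has a single nonzero coordinate, hence lies in every class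
  with \<open>k \<ge> 1\<close>.

  In terms of the noise, changing the \<open>j\<close>-th mean by \<open>\<plusminus> r\<close> shifts \<open>\<epsilon> j\<close> by \<open>\<plusminus> a\<^sub>j\<close> with
  \<open>a\<^sub>j = r / \<sigma> j\<close>, and by the Cameron--Martin formula (lemma \<open>cameron_martin\<close>) this is the same as
  weighting by an exponential density. All first and second moments of these densities follow from
  that formula applied to the densities themselves. The likelihood ratio \<open>L\<close> of the mixture
  satisfies \<open>E L = 1\<close> and
  \<open>E (L - 1)\<^sup>2 = (\<Sum>j\<in>S. cosh (a\<^sub>j\<^sup>2) - 1) / |S|\<^sup>2\<close>,
  because distinct coordinates are uncorrelated and the random sign turns \<open>exp\<close> into \<open>cosh\<close>.
  Since \<open>a\<^sub>j\<^sup>2 \<le> ln (1 + m)\<close>, each summand is at most \<open>m / 2\<close>, so the variance is at most \<open>1 / 2\<close>.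

  Finally \<open>E (L - 1) 1\<^sub>A = E (L - 1) (1\<^sub>A - 1 / 2) \<le> E \<bar>L - 1\<bar> / 2 \<le> (1 + E (L - 1)\<^sup>2) / 4 \<le> 3 / 8\<close>
  for every event \<open>A\<close> (lemma \<open>average_power_le\<close>). A level-\<open>\<alpha>\<close> test therefore has power at most
  \<open>\<alpha> + 3 / 8\<close> at some spike (lemma \<open>ex_spike_power_le\<close>), which is below \<open>1 - \<beta>\<close> because
  \<open>\<alpha> + \<beta> \<le> 0.59 < 5 / 8\<close>. The symmetric prior matters here: with positive spikes only, the
  variance bound would be \<open>1\<close> rather than \<open>1 / 2\<close>, and even the sharper estimate
  \<open>E \<bar>L - 1\<bar> / 2 \<le> sqrt (E (L - 1)\<^sup>2) / 2\<close> would only reach \<open>\<alpha> + \<beta> < 1 / 2\<close>.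
\<close>

section \<open>Likelihood ratios of Gaussian shifts\<close>

abbreviation noise_law :: "nat set \<Rightarrow> (nat \<Rightarrow> real) measure" where
  "noise_law J \<equiv> \<Pi>\<^sub>M j\<in>J. std_normal_distribution"

text \<open>The density of the normal law with mean \<open>a\<close> and variance \<open>1\<close> with respect to the standard one.\<close>

definition tilt :: "real \<Rightarrow> real \<Rightarrow> real" where
  "tilt a x = exp (a * x - a\<^sup>2 / 2)"

lemma tilt_pos: "tilt a x > 0"
  by (simp add: tilt_def)

lemma measurable_tilt [measurable]: "tilt a \<in> borel_measurable borel"
  unfolding tilt_def by measurable

lemma tilt_shift: "tilt b (x + a) = exp (a * b) * tilt b x"
  by (simp add: tilt_def exp_add [symmetric] algebra_simps)

lemma prob_space_std_normal: "prob_space std_normal_distribution"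
  by (simp add: prob_space_normal_density)

lemma prob_space_noise_law: "prob_space (noise_law J)"
  by (intro prob_space_PiM prob_space_std_normal)

lemma sets_noise_law [measurable_cong]: "sets (noise_law J) = sets (\<Pi>\<^sub>M j\<in>J. borel)"
  by (intro sets_PiM_cong) simp_all

lemma space_noise_law: "space (noise_law J) = J \<rightarrow>\<^sub>E UNIV"
  by (simp add: space_PiM)

text \<open>Translation invariance of Lebesgue measure moves the shift into the normal density.\<close>

lemma std_normal_shift:
  assumes [measurable]: "f \<in> borel_measurable borel"
  shows "(\<integral>\<^sup>+x. f (x + a) \<partial>std_normal_distribution) =
         (\<integral>\<^sup>+x. ennreal (tilt a x) * f x \<partial>std_normal_distribution)"
proof -
  have dens: "std_normal_density (x - a) = std_normal_density x * tilt a x" for x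
    by (simp add: normal_density_def tilt_def exp_add [symmetric] power2_eq_square algebra_simps
        diff_divide_distrib add_divide_distrib)
  have "(\<integral>\<^sup>+x. f (x + a) \<partial>std_normal_distribution) =
      (\<integral>\<^sup>+x. ennreal (std_normal_density x) * f (x + a) \<partial>lborel)"
    by (subst nn_integral_density) auto
  also have "\<dots> = (\<integral>\<^sup>+x. ennreal (std_normal_density (x - a)) * f x \<partial>lborel)"
    by (subst nn_integral_real_affine [where c = 1 and t = "-a"]) auto
  also have "\<dots> = (\<integral>\<^sup>+x. ennreal (std_normal_density x) * (ennreal (tilt a x) * f x) \<partial>lborel)"
    using tilt_pos by (simp add: dens ennreal_mult less_imp_le mult.assoc)
  also have "\<dots> = (\<integral>\<^sup>+x. ennreal (tilt a x) * f x \<partial>std_normal_distribution)"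
    by (subst nn_integral_density) auto
  finally show ?thesis .
qed

text \<open>
  Tonelli for a single coordinate: since all factors are probability measures, this holds for infinite
  \<open>J\<close> too. It reduces statements about shifting one coordinate to the real line.
\<close>

lemma nn_integral_noise_law_coordinate:
  assumes j: "j \<in> J" and [measurable]: "g \<in> borel_measurable (\<Pi>\<^sub>M j\<in>J. borel)"
  shows "(\<integral>\<^sup>+\<epsilon>. g \<epsilon> \<partial>noise_law J) =
         (\<integral>\<^sup>+X. (\<integral>\<^sup>+x. g (X(j := x)) \<partial>std_normal_distribution) \<partial>noise_law (J - {j}))"
proof -
  interpret prob_space "noise_law (J - {j})" by (rule prob_space_noise_law)
  interpret N: prob_space std_normal_distribution by (rule prob_space_std_normal)
  interpret pair_sigma_finite std_normal_distribution "noise_law (J - {j})" ..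
  have ins: "insert j (J - {j}) = J" using j by blast
  have [measurable]: "(\<lambda>(x, X). X(j := x)) \<in>
      std_normal_distribution \<Otimes>\<^sub>M noise_law (J - {j}) \<rightarrow>\<^sub>M (\<Pi>\<^sub>M j\<in>J. borel)"
  proof -
    have "(\<lambda>p. (snd p)(j := fst p)) \<in>
      std_normal_distribution \<Otimes>\<^sub>M noise_law (J - {j}) \<rightarrow>\<^sub>M (\<Pi>\<^sub>M j\<in>insert j (J - {j}). borel)"
      by (rule measurable_fun_upd [where J = "J - {j}"]) auto
    then show ?thesis by (simp add: ins case_prod_beta' del: insert_Diff_single)
  qed
  have eq: "noise_law J = distr (std_normal_distribution \<Otimes>\<^sub>M noise_law (J - {j})) (noise_law J)
      (\<lambda>(x, X). X(j := x))"
    using distr_pair_PiM_eq_PiM [where M = "\<lambda>_. std_normal_distribution" and i' = j and I = "J - {j}"]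
    by (simp add: ins prob_space_std_normal del: insert_Diff_single)
  have "(\<integral>\<^sup>+\<epsilon>. g \<epsilon> \<partial>noise_law J) =
      (\<integral>\<^sup>+p. g ((\<lambda>(x, X). X(j := x)) p) \<partial>(std_normal_distribution \<Otimes>\<^sub>M noise_law (J - {j})))"
    by (subst eq, subst nn_integral_distr) auto
  also have "\<dots> = (\<integral>\<^sup>+X. (\<integral>\<^sup>+x. g (X(j := x)) \<partial>std_normal_distribution) \<partial>noise_law (J - {j}))"
    by (subst nn_integral_snd [symmetric]) (auto simp: case_prod_beta')
  finally show ?thesis .
qed

lemma measurable_shift:
  assumes "j \<in> J"
  shows "(\<lambda>\<epsilon>. \<epsilon>(j := \<epsilon> j + a)) \<in> (\<Pi>\<^sub>M j\<in>J. borel) \<rightarrow>\<^sub>M (\<Pi>\<^sub>M j\<in>J. (borel :: real measure))"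
  using assms by (intro measurable_fun_upd [where J = J]) auto

text \<open>
  Integrate out the other coordinates last and apply the one-dimensional shift formula inside.
  Taking \<open>g\<close> to be a density, or an indicator, gives the moments and the shifted probabilities below.
\<close>

lemma cameron_martin:
  assumes j: "j \<in> J" and g [measurable]: "g \<in> borel_measurable (\<Pi>\<^sub>M j\<in>J. borel)"
  shows "(\<integral>\<^sup>+\<epsilon>. g (\<epsilon>(j := \<epsilon> j + a)) \<partial>noise_law J) =
         (\<integral>\<^sup>+\<epsilon>. ennreal (tilt a (\<epsilon> j)) * g \<epsilon> \<partial>noise_law J)"
proof -
  have m [measurable]: "(\<lambda>\<epsilon>. g (\<epsilon>(j := \<epsilon> j + a))) \<in> borel_measurable (\<Pi>\<^sub>M j\<in>J. borel)"
    by (rule measurable_compose [OF measurable_shift [OF j] g])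
  have m' [measurable]: "(\<lambda>\<epsilon>. ennreal (tilt a (\<epsilon> j)) * g \<epsilon>) \<in> borel_measurable (\<Pi>\<^sub>M j\<in>J. borel)"
    using j by measurable
  have upd: "(\<lambda>x. g (X(j := x))) \<in> borel_measurable borel" if "X \<in> space (noise_law (J - {j}))" for X
  proof -
    have "(\<lambda>x. X(j := x)) \<in> borel \<rightarrow>\<^sub>M (\<Pi>\<^sub>M j\<in>J. borel)"
      using that j by (intro measurable_fun_upd [where J = "J - {j}"]) (auto simp: space_PiM)
    then show ?thesis by (rule measurable_compose) (rule g)
  qed
  have "(\<integral>\<^sup>+\<epsilon>. g (\<epsilon>(j := \<epsilon> j + a)) \<partial>noise_law J) =
      (\<integral>\<^sup>+X. (\<integral>\<^sup>+x. g (X(j := x + a)) \<partial>std_normal_distribution) \<partial>noise_law (J - {j}))"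
    by (subst nn_integral_noise_law_coordinate [OF j m]) simp
  also have "\<dots> = (\<integral>\<^sup>+X. (\<integral>\<^sup>+x. ennreal (tilt a x) * g (X(j := x))
      \<partial>std_normal_distribution) \<partial>noise_law (J - {j}))"
    by (intro nn_integral_cong std_normal_shift upd)
  also have "\<dots> = (\<integral>\<^sup>+\<epsilon>. ennreal (tilt a (\<epsilon> j)) * g \<epsilon> \<partial>noise_law J)"
    by (subst nn_integral_noise_law_coordinate [OF j m']) simp
  finally show ?thesis .
qed

lemma nn_integral_tilt:
  assumes "j \<in> J"
  shows "(\<integral>\<^sup>+\<epsilon>. ennreal (tilt a (\<epsilon> j)) \<partial>noise_law J) = 1"
  using cameron_martin [OF assms, of "\<lambda>_. 1" a] prob_space.emeasure_space_1 [OF prob_space_noise_law]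
  by simp

text \<open>
  One density is absorbed as a shift of the other: the shift multiplies it by \<open>exp (a * b)\<close> on the same
  coordinate and leaves it unchanged on a different one.
\<close>

lemma nn_integral_tilt_tilt:
  assumes i: "i \<in> J" and j: "j \<in> J"
  shows "(\<integral>\<^sup>+\<epsilon>. ennreal (tilt a (\<epsilon> i) * tilt b (\<epsilon> j)) \<partial>noise_law J) =
         ennreal (if i = j then exp (a * b) else 1)"
proof -
  have m [measurable]: "(\<lambda>\<epsilon>. ennreal (tilt b (\<epsilon> j))) \<in> borel_measurable (\<Pi>\<^sub>M j\<in>J. borel)"
    using j by measurable
  have "(\<integral>\<^sup>+\<epsilon>. ennreal (tilt a (\<epsilon> i) * tilt b (\<epsilon> j)) \<partial>noise_law J) =
      (\<integral>\<^sup>+\<epsilon>. ennreal (tilt a (\<epsilon> i)) * ennreal (tilt b (\<epsilon> j)) \<partial>noise_law J)"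
    by (simp add: ennreal_mult tilt_pos less_imp_le)
  also have "\<dots> = (\<integral>\<^sup>+\<epsilon>. ennreal (tilt b ((\<epsilon>(i := \<epsilon> i + a)) j)) \<partial>noise_law J)"
    by (rule cameron_martin [OF i m, symmetric])
  also have "\<dots> = (\<integral>\<^sup>+\<epsilon>. ennreal (if i = j then exp (a * b) else 1) * ennreal (tilt b (\<epsilon> j)) \<partial>noise_law J)"
    by (intro nn_integral_cong) (auto simp: tilt_shift ennreal_mult tilt_pos less_imp_le)
  also have "\<dots> = ennreal (if i = j then exp (a * b) else 1)"
    by (subst nn_integral_cmult) (use j in \<open>auto simp: nn_integral_tilt\<close>)
  finally show ?thesis .
qed

lemma has_bochner_integral_tilt:
  assumes "j \<in> J"
  shows "has_bochner_integral (noise_law J) (\<lambda>\<epsilon>. tilt a (\<epsilon> j)) 1"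
  using assms by (intro has_bochner_integral_nn_integral)
    (auto simp: nn_integral_tilt tilt_pos less_imp_le)

lemma has_bochner_integral_tilt_tilt:
  assumes "i \<in> J" "j \<in> J"
  shows "has_bochner_integral (noise_law J) (\<lambda>\<epsilon>. tilt a (\<epsilon> i) * tilt b (\<epsilon> j))
           (if i = j then exp (a * b) else 1)"
  using assms by (intro has_bochner_integral_nn_integral)
    (auto simp: nn_integral_tilt_tilt tilt_pos less_imp_le)

lemma prob_shift:
  assumes j: "j \<in> J" and A [measurable]: "A \<in> sets (\<Pi>\<^sub>M j\<in>J. borel)"
  shows "has_bochner_integral (noise_law J) (\<lambda>\<epsilon>. tilt a (\<epsilon> j) * indicator A \<epsilon>)
      (measure (noise_law J) {\<epsilon> \<in> space (noise_law J). \<epsilon>(j := \<epsilon> j + a) \<in> A})"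
proof (rule has_bochner_integral_nn_integral)
  interpret prob_space "noise_law J" by (rule prob_space_noise_law)
  note measurable_shift [OF j, measurable]
  have "(\<integral>\<^sup>+\<epsilon>. ennreal (tilt a (\<epsilon> j) * indicator A \<epsilon>) \<partial>noise_law J) =
      (\<integral>\<^sup>+\<epsilon>. ennreal (tilt a (\<epsilon> j)) * indicator A \<epsilon> \<partial>noise_law J)"
    by (intro nn_integral_cong) (auto split: split_indicator)
  also have "\<dots> = (\<integral>\<^sup>+\<epsilon>. indicator A (\<epsilon>(j := \<epsilon> j + a)) \<partial>noise_law J)"
    by (rule cameron_martin [OF j, symmetric]) measurable
  also have "\<dots> = (\<integral>\<^sup>+\<epsilon>. indicator {\<epsilon> \<in> space (noise_law J). \<epsilon>(j := \<epsilon> j + a) \<in> A} \<epsilon> \<partial>noise_law J)"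
    by (intro nn_integral_cong) (auto split: split_indicator)
  also have "\<dots> = emeasure (noise_law J) {\<epsilon> \<in> space (noise_law J). \<epsilon>(j := \<epsilon> j + a) \<in> A}"
    by (rule nn_integral_indicator) measurable
  finally show "(\<integral>\<^sup>+\<epsilon>. ennreal (tilt a (\<epsilon> j) * indicator A \<epsilon>) \<partial>noise_law J) =
      ennreal (measure (noise_law J) {\<epsilon> \<in> space (noise_law J). \<epsilon>(j := \<epsilon> j + a) \<in> A})"
    by (simp add: emeasure_eq_measure)
qed (use j in \<open>auto simp: tilt_pos less_imp_le\<close>)

section \<open>Bayesian bound for a symmetric one-spike prior\<close>

definition sym_tilt :: "real \<Rightarrow> real \<Rightarrow> real" where
  "sym_tilt a x = (tilt a x + tilt (-a) x) / 2"

lemma has_bochner_integral_sym_tilt: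
  assumes "j \<in> J"
  shows "has_bochner_integral (noise_law J) (\<lambda>\<epsilon>. sym_tilt a (\<epsilon> j)) 1"
  using has_bochner_integral_divide_zero [OF has_bochner_integral_add
      [OF has_bochner_integral_tilt has_bochner_integral_tilt], OF assms assms, of a "-a" 2]
  by (simp add: sym_tilt_def)

lemma has_bochner_integral_sym_tilt_sym_tilt:
  assumes i: "i \<in> J" and j: "j \<in> J"
  shows "has_bochner_integral (noise_law J) (\<lambda>\<epsilon>. sym_tilt (a i) (\<epsilon> i) * sym_tilt (a j) (\<epsilon> j))
           (if i = j then cosh ((a j)\<^sup>2) else 1)"
proof -
  note h = has_bochner_integral_tilt_tilt [OF i j]
  have "has_bochner_integral (noise_law J)
      (\<lambda>\<epsilon>. (((tilt (a i) (\<epsilon> i) * tilt (a j) (\<epsilon> j)) + (tilt (a i) (\<epsilon> i) * tilt (- a j) (\<epsilon> j)))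
         + ((tilt (- a i) (\<epsilon> i) * tilt (a j) (\<epsilon> j)) + (tilt (- a i) (\<epsilon> i) * tilt (- a j) (\<epsilon> j)))) / 4)
      ((((if i = j then exp (a i * a j) else 1) + (if i = j then exp (a i * - a j) else 1))
       + ((if i = j then exp (- a i * a j) else 1) + (if i = j then exp (- a i * - a j) else 1))) / 4)"
    by (intro has_bochner_integral_divide_zero has_bochner_integral_add h)
  then show ?thesis
    by (rule has_bochner_integral_cong [THEN iffD1, rotated -1])
       (auto simp: sym_tilt_def algebra_simps cosh_def power2_eq_square)
qed

text \<open>
  The event \<open>A\<close> stands for rejection. The first term on the left is its probability under the mixture,
  that is \<open>E (L * 1\<^sub>A)\<close> with \<open>L\<close> the likelihood ratio, so the left side is \<open>E ((L - 1) * 1\<^sub>A)\<close>. As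
  \<open>E (L - 1) = 0\<close>, the indicator may be centred at \<open>1 / 2\<close>, which halves the bound; then
  \<open>\<bar>x\<bar> \<le> (1 + x\<^sup>2) / 2\<close> replaces Cauchy--Schwarz. The right side is thus \<open>(1 + E (L - 1)\<^sup>2) / 4\<close>.
\<close>

lemma average_power_le:
  assumes S: "finite S" "S \<noteq> {}" "S \<subseteq> J" and A [measurable]: "A \<in> sets (\<Pi>\<^sub>M j\<in>J. borel)"
  defines "p j b \<equiv> measure (noise_law J) {\<epsilon> \<in> space (noise_law J). \<epsilon>(j := \<epsilon> j + b) \<in> A}"
  shows "(\<Sum>j\<in>S. (p j (a j) + p j (- a j)) / 2) / card S - measure (noise_law J) A
           \<le> (1 + (\<Sum>j\<in>S. cosh ((a j)\<^sup>2) - 1) / (card S)\<^sup>2) / 4"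
proof -
  interpret prob_space "noise_law J" by (rule prob_space_noise_law)
  let ?D = "\<lambda>j \<epsilon>. sym_tilt (a j) (\<epsilon> j)"
  define m where "m = real (card S)"
  have m: "m > 0" using S by (simp add: m_def card_gt_0_iff)
  define L where "L = (\<lambda>\<epsilon>. (\<Sum>j\<in>S. ?D j \<epsilon>) / m)"
  define p1 where "p1 = (\<Sum>j\<in>S. (p j (a j) + p j (- a j)) / 2) / m"
  define v where "v = (\<Sum>j\<in>S. cosh ((a j)\<^sup>2) - 1) / m\<^sup>2"
  have L1: "has_bochner_integral (noise_law J) L 1"
  proof -
    have "has_bochner_integral (noise_law J) L ((\<Sum>j\<in>S. 1) / m)"
      unfolding L_def using S
      by (intro has_bochner_integral_divide_zero has_bochner_integral_sum
          has_bochner_integral_sym_tilt) auto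
    then show ?thesis using m by (simp add: m_def)
  qed
  have L2: "has_bochner_integral (noise_law J) (\<lambda>\<epsilon>. (L \<epsilon>)\<^sup>2) (1 + v)"
  proof -
    have "has_bochner_integral (noise_law J) (\<lambda>\<epsilon>. (\<Sum>i\<in>S. \<Sum>j\<in>S. ?D i \<epsilon> * ?D j \<epsilon>) / m\<^sup>2)
        ((\<Sum>i\<in>S. \<Sum>j\<in>S. if i = j then cosh ((a j)\<^sup>2) else 1) / m\<^sup>2)"
      using S by (intro has_bochner_integral_divide_zero has_bochner_integral_sum
          has_bochner_integral_sym_tilt_sym_tilt) auto
    moreover have "(\<lambda>\<epsilon>. (\<Sum>i\<in>S. \<Sum>j\<in>S. ?D i \<epsilon> * ?D j \<epsilon>) / m\<^sup>2) = (\<lambda>\<epsilon>. (L \<epsilon>)\<^sup>2)"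
      by (simp add: L_def power2_eq_square sum_product)
    moreover have "(\<Sum>i\<in>S. \<Sum>j\<in>S. if i = j then cosh ((a j)\<^sup>2) else 1) / m\<^sup>2 = 1 + v"
    proof -
      have "(\<Sum>i\<in>S. \<Sum>j\<in>S. if i = j then cosh ((a j)\<^sup>2) else 1) =
          (\<Sum>i\<in>S. \<Sum>j\<in>S. 1 + (if i = j then cosh ((a j)\<^sup>2) - 1 else 0))"
        by (intro sum.cong) auto
      also have "\<dots> = m\<^sup>2 + (\<Sum>i\<in>S. cosh ((a i)\<^sup>2) - 1)"
        using S by (simp add: sum.distrib m_def power2_eq_square)
      finally show ?thesis using m by (simp add: v_def add_divide_distrib)
    qed
    ultimately show ?thesis by simp
  qed
  have LA: "has_bochner_integral (noise_law J) (\<lambda>\<epsilon>. L \<epsilon> * indicator A \<epsilon>) p1"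
  proof -
    have "has_bochner_integral (noise_law J)
        (\<lambda>\<epsilon>. (\<Sum>j\<in>S. (tilt (a j) (\<epsilon> j) * indicator A \<epsilon> + tilt (- a j) (\<epsilon> j) * indicator A \<epsilon>) / 2) / m) p1"
      unfolding p1_def p_def using S
      by (intro has_bochner_integral_divide_zero has_bochner_integral_sum has_bochner_integral_add
          prob_shift A) auto
    moreover have "(\<lambda>\<epsilon>. (\<Sum>j\<in>S. (tilt (a j) (\<epsilon> j) * indicator A \<epsilon> + tilt (- a j) (\<epsilon> j) * indicator A \<epsilon>) / 2) / m)
        = (\<lambda>\<epsilon>. L \<epsilon> * indicator A \<epsilon>)"
      by (simp add: L_def sym_tilt_def sum_distrib_right add_divide_distrib distrib_right)
    ultimately show ?thesis by simp
  qed
  have A1: "has_bochner_integral (noise_law J) (indicator A :: _ \<Rightarrow> real) (measure (noise_law J) A)"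
    by (rule has_bochner_integral_real_indicator) (simp_all add: sets_noise_law emeasure_eq_measure)
  have one: "has_bochner_integral (noise_law J) (\<lambda>_. 1 :: real) 1"
    using has_bochner_integral_integrable [of "noise_law J" "\<lambda>_. 1 :: real"] prob_space by simp
  have lhs: "has_bochner_integral (noise_law J) (\<lambda>\<epsilon>. L \<epsilon> * indicator A \<epsilon> - indicator A \<epsilon>)
      (p1 - measure (noise_law J) A)"
    by (intro has_bochner_integral_diff LA A1)
  have rhs: "has_bochner_integral (noise_law J)
      (\<lambda>\<epsilon>. (1 + ((L \<epsilon>)\<^sup>2 - 2 * L \<epsilon> + 1)) / 4 + (L \<epsilon> - 1) / 2)
      ((1 + ((1 + v) - 2 * 1 + 1)) / 4 + (1 - 1) / 2)"
    by (intro has_bochner_integral_diff has_bochner_integral_add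
        has_bochner_integral_divide_zero has_bochner_integral_mult_right L1 L2 one)
  \<comment> \<open>With \<open>x = L \<epsilon> - 1\<close> the claim is \<open>x * 1\<^sub>A \<le> (1 + x\<^sup>2) / 4 + x / 2\<close>. The difference of the two sides
    is \<open>(x - 1)\<^sup>2 / 4 = (L \<epsilon> - 2)\<^sup>2 / 4\<close> on \<open>A\<close> and \<open>(x + 1)\<^sup>2 / 4 = (L \<epsilon>)\<^sup>2 / 4\<close> off \<open>A\<close>.\<close>
  have "L \<epsilon> * indicator A \<epsilon> - indicator A \<epsilon> \<le> (1 + ((L \<epsilon>)\<^sup>2 - 2 * L \<epsilon> + 1)) / 4 + (L \<epsilon> - 1) / 2" for \<epsilon>
  proof -
    have "0 \<le> (L \<epsilon> - 2)\<^sup>2" "0 \<le> (L \<epsilon>)\<^sup>2" by simp_all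
    then show ?thesis
      by (cases "\<epsilon> \<in> A") (simp_all add: power2_eq_square field_simps)
  qed
  then have "p1 - measure (noise_law J) A \<le> (1 + ((1 + v) - 2 * 1 + 1)) / 4 + (1 - 1) / 2"
    using integral_mono [OF integrable.intros [OF lhs] integrable.intros [OF rhs]]
    unfolding has_bochner_integral_integral_eq [OF lhs] has_bochner_integral_integral_eq [OF rhs]
    by blast
  then show ?thesis by (simp add: p1_def v_def m_def)
qed

section \<open>Spikes in the sparse class\<close>

definition spike :: "nat set \<Rightarrow> nat \<Rightarrow> real \<Rightarrow> nat \<Rightarrow> real" where
  "spike J j r = (\<lambda>i\<in>J. if i = j then r else 0)"

lemma spike_in_sparse_set:
  assumes j: "j \<in> J" "j \<le> n" and k: "1 \<le> k"
  shows "spike J j r \<in> sparse_set J k n"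
proof -
  have "(\<lambda>i. (spike J j r i)\<^sup>2) summable_on {j}" by (rule summable_on_finite) simp
  then have "(\<lambda>i. (spike J j r i)\<^sup>2) summable_on J"
    by (rule summable_on_cong_neutral [THEN iffD1, rotated -1]) (use j in \<open>auto simp: spike_def\<close>)
  moreover have "card {i \<in> J. i \<le> n \<and> spike J j r i \<noteq> 0} \<le> card {j}"
    by (rule card_mono) (auto simp: spike_def split: if_splits)
  ultimately show ?thesis
    using j k by (auto simp: sparse_set_def l_two_def spike_def)
qed

lemma sup_norm_spike:
  assumes "j \<in> J"
  shows "sup_norm J (spike J j r) = \<bar>r\<bar>"
  unfolding sup_norm_def
proof (rule cSup_eq_maximum)
  show "\<bar>r\<bar> \<in> (\<lambda>i. \<bar>spike J j r i\<bar>) ` J"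
    by (rule image_eqI [of _ _ j]) (use assms in \<open>auto simp: spike_def\<close>)
qed (auto simp: spike_def)

text \<open>
  The rejection event under the null hypothesis, as a set of noise sequences. Expressing every
  alternative through this one set turns a change of mean into a shift of the noise.
\<close>

definition rejection_region where
  "rejection_region J \<sigma> \<Phi> = {\<epsilon> \<in> J \<rightarrow>\<^sub>E UNIV. \<Phi> (\<lambda>i\<in>J. \<sigma> i * \<epsilon> i) = (1::nat)}"

lemma reject_prob_noise:
  assumes \<Phi>: "\<Phi> \<in> tests J"
  shows "reject_prob J \<sigma> \<theta> \<Phi> =
    measure (noise_law J) {\<epsilon> \<in> space (noise_law J). \<Phi> (\<lambda>i\<in>J. \<theta> i + \<sigma> i * \<epsilon> i) = 1}"
proof -
  have [measurable]: "\<Phi> \<in> (\<Pi>\<^sub>M j\<in>J. borel) \<rightarrow>\<^sub>M count_space {0, 1}"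
    using \<Phi> by (simp add: tests_def)
  have m: "(\<lambda>\<epsilon>. \<lambda>j\<in>J. \<theta> j + \<sigma> j * \<epsilon> j) \<in> noise_law J \<rightarrow>\<^sub>M (\<Pi>\<^sub>M j\<in>J. borel)"
    by measurable
  have "{y \<in> space (\<Pi>\<^sub>M j\<in>J. borel). \<Phi> y = 1} \<in> sets (\<Pi>\<^sub>M j\<in>J. (borel :: real measure))"
    by measurable
  from measure_distr [OF m this] show ?thesis
    using measurable_space [OF m]
    by (auto simp: reject_prob_def obs_law_def intro!: arg_cong [where f = "measure (noise_law J)"])
qed

lemma rejection_region_measurable:
  assumes \<Phi>: "\<Phi> \<in> tests J"
  shows "rejection_region J \<sigma> \<Phi> \<in> sets (\<Pi>\<^sub>M j\<in>J. borel)"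
proof -
  have [measurable]: "\<Phi> \<in> (\<Pi>\<^sub>M j\<in>J. borel) \<rightarrow>\<^sub>M count_space {0, 1}"
    using \<Phi> by (simp add: tests_def)
  have "{\<epsilon> \<in> space (\<Pi>\<^sub>M j\<in>J. borel). \<Phi> (\<lambda>i\<in>J. \<sigma> i * \<epsilon> i) = 1} \<in> sets (\<Pi>\<^sub>M j\<in>J. (borel :: real measure))"
    by measurable
  then show ?thesis by (simp add: rejection_region_def space_PiM)
qed

lemma reject_prob_null:
  assumes "\<Phi> \<in> tests J"
  shows "reject_prob J \<sigma> (\<lambda>j\<in>J. 0) \<Phi> = measure (noise_law J) (rejection_region J \<sigma> \<Phi>)"
  unfolding reject_prob_noise [OF assms] rejection_region_def space_noise_law
  by (rule arg_cong [where f = "measure (noise_law J)"]) (auto cong: restrict_cong)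

lemma reject_prob_spike:
  assumes "\<Phi> \<in> tests J" and j: "j \<in> J" and "\<sigma> j > 0"
  shows "reject_prob J \<sigma> (spike J j r) \<Phi> =
    measure (noise_law J) {\<epsilon> \<in> space (noise_law J). \<epsilon>(j := \<epsilon> j + r / \<sigma> j) \<in> rejection_region J \<sigma> \<Phi>}"
proof -
  have "(\<lambda>i\<in>J. spike J j r i + \<sigma> i * \<epsilon> i) = (\<lambda>i\<in>J. \<sigma> i * (\<epsilon>(j := \<epsilon> j + r / \<sigma> j)) i)" for \<epsilon>
    using assms by (auto simp: spike_def algebra_simps)
  moreover have "\<epsilon>(j := \<epsilon> j + r / \<sigma> j) \<in> J \<rightarrow>\<^sub>E UNIV" if "\<epsilon> \<in> J \<rightarrow>\<^sub>E UNIV" for \<epsilon> :: "nat \<Rightarrow> real"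
    using that j by (auto simp: PiE_def extensional_def)
  ultimately show ?thesis
    unfolding reject_prob_noise [OF assms(1)] rejection_region_def space_noise_law
    by (intro arg_cong [where f = "measure (noise_law J)"]) (auto simp del: fun_upd_apply)
qed

section \<open>Order statistics and the lower bound\<close>

text \<open>
  Ties are harmless: in the sorted list everything from position \<open>l\<close> on is at least the entry there,
  and sorting preserves the multiset of values.
\<close>

lemma card_ge_order_stat:
  assumes l: "l < n"
  shows "n - l \<le> card {j \<in> {1..n}. order_stat \<sigma> n (l + 1) \<le> \<sigma> j}"
proof -
  let ?xs = "sort (map \<sigma> [1..<n+1])"
  define c where "c = ?xs ! l"
  have "n - l = length (drop l ?xs)" by simp
  also have "drop l ?xs = filter ((\<le>) c) (drop l ?xs)"
  proof (rule filter_True [symmetric], rule ballI)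
    fix x assume "x \<in> set (drop l ?xs)"
    then obtain i where "i < length (drop l ?xs)" "x = drop l ?xs ! i" by (metis in_set_conv_nth)
    then show "c \<le> x" using l by (auto simp: c_def intro!: sorted_nth_mono)
  qed
  also have "length (filter ((\<le>) c) (drop l ?xs)) \<le> length (filter ((\<le>) c) ?xs)"
    by (metis append_take_drop_id filter_append le_add2 length_append)
  also have "\<dots> = size (filter_mset ((\<le>) c) (mset ?xs))"
    by (metis mset_filter size_mset)
  also have "\<dots> = length (filter ((\<le>) c) (map \<sigma> [1..<n+1]))"
    by (metis mset_filter mset_sort size_mset)
  also have "\<dots> = length (filter (\<lambda>j. c \<le> \<sigma> j) [1..<n+1])"
    by (simp add: filter_map comp_def)
  also have "\<dots> = card (set (filter (\<lambda>j. c \<le> \<sigma> j) [1..<n+1]))"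
    by (rule distinct_card [symmetric]) simp
  also have "set (filter (\<lambda>j. c \<le> \<sigma> j) [1..<n+1]) = {j \<in> {1..n}. order_stat \<sigma> n (l + 1) \<le> \<sigma> j}"
    by (auto simp: c_def order_stat_def)
  finally show ?thesis .
qed

lemma order_stat_pos:
  assumes "\<And>j. j \<in> {1..n} \<Longrightarrow> \<sigma> j > 0" and l: "l < n"
  shows "order_stat \<sigma> n (l + 1) > 0"
proof -
  have "order_stat \<sigma> n (l + 1) \<in> set (sort (map \<sigma> [1..<n+1]))"
    unfolding order_stat_def using l by (intro nth_mem) simp
  then show ?thesis using assms(1) by auto
qed

text \<open>
  At the endpoint \<open>x = ln (1 + m)\<close> the left side equals \<open>m\<^sup>2 / (2 * (1 + m))\<close>. This is where the
  radius \<open>sqrt (ln (1 + m))\<close> comes from: it is what makes the variance of the likelihood ratio bounded.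
\<close>

lemma cosh_ln_le:
  assumes "0 \<le> x" "x \<le> ln (1 + m)" "0 < (m::real)"
  shows "cosh x - 1 \<le> m / 2"
proof -
  have "cosh x \<le> cosh (ln (1 + m))" using assms by (subst cosh_real_nonneg_le_iff) auto
  also have "\<dots> = (1 + m + inverse (1 + m)) / 2" using assms by (subst cosh_ln_real) auto
  also have "\<dots> \<le> 1 + m / 2" using assms by (simp add: field_simps)
  finally show ?thesis by simp
qed

text \<open>
  If all spikes of height \<open>\<plusminus> r\<close> were detected with probability above \<open>\<alpha> + 3 / 8\<close>, so would be their
  uniform mixture over the coordinates with large \<open>\<sigma>\<close>, against the bound on average power.
\<close>

lemma ex_spike_power_le:
  assumes J: "{1..n} \<subseteq> J" and \<sigma>: "\<forall>j\<in>J. \<sigma> j > 0" and l: "l < n"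
    and \<Phi>: "\<Phi> \<in> level_tests J \<sigma> \<alpha>"
  defines "r \<equiv> order_stat \<sigma> n (l + 1) * sqrt (ln (1 + real n - real l))"
  shows "\<exists>j\<in>{1..n}. \<exists>s\<in>{r, - r}. reject_prob J \<sigma> (spike J j s) \<Phi> \<le> \<alpha> + 3 / 8"
proof (rule ccontr)
  assume neg: "\<not> ?thesis"
  define c where "c = order_stat \<sigma> n (l + 1)"
  define S where "S = {j \<in> {1..n}. c \<le> \<sigma> j}"
  let ?A = "rejection_region J \<sigma> \<Phi>"
  define p where "p = (\<lambda>j a. measure (noise_law J) {\<epsilon> \<in> space (noise_law J). \<epsilon>(j := \<epsilon> j + a) \<in> ?A})"
  have \<Phi>': "\<Phi> \<in> tests J" and level: "measure (noise_law J) ?A \<le> \<alpha>"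
    using \<Phi> reject_prob_null by (auto simp: level_tests_def)
  have c: "c > 0" unfolding c_def using J \<sigma> l by (intro order_stat_pos) auto
  have card: "n - l \<le> card S" using card_ge_order_stat [OF l] by (simp add: S_def c_def)
  define m where "m = real n - real l"
  have m: "m > 0" "m \<le> card S" using l card by (auto simp: m_def)
  have S: "finite S" "S \<noteq> {}" "S \<subseteq> J"
  proof -
    have "card S > 0" using m by linarith
    then show "finite S" "S \<noteq> {}" by (auto simp: card_gt_0_iff)
    show "S \<subseteq> J" using J by (auto simp: S_def)
  qed
  have r2: "r\<^sup>2 = c\<^sup>2 * ln (1 + m)"
    using m by (simp add: r_def c_def m_def power_mult_distrib add_diff_eq)
  \<comment> \<open>The noise level on \<open>S\<close> is at least \<open>c\<close>, so the standardized spikes are no larger than at level \<open>c\<close>.\<close>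
  have cosh_le: "cosh ((r / \<sigma> j)\<^sup>2) - 1 \<le> m / 2" if "j \<in> S" for j
  proof (rule cosh_ln_le)
    have "c\<^sup>2 \<le> (\<sigma> j)\<^sup>2" "\<sigma> j > 0" using that c by (auto simp: S_def intro!: power_mono)
    then show "(r / \<sigma> j)\<^sup>2 \<le> ln (1 + m)"
      using m by (simp add: power_divide r2 divide_le_eq mult.commute mult_left_mono)
  qed (use m in auto)
  have "(\<Sum>j\<in>S. cosh ((r / \<sigma> j)\<^sup>2) - 1) / (card S)\<^sup>2 \<le> (card S * (card S / 2)) / (card S)\<^sup>2"
  proof (rule divide_right_mono)
    have "(\<Sum>j\<in>S. cosh ((r / \<sigma> j)\<^sup>2) - 1) \<le> (\<Sum>j\<in>S. card S / 2)"
      using cosh_le m by (intro sum_mono) fastforce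
    then show "(\<Sum>j\<in>S. cosh ((r / \<sigma> j)\<^sup>2) - 1) \<le> card S * (card S / 2)" by simp
  qed simp
  also have "\<dots> = 1 / 2" using m by (simp add: power2_eq_square)
  finally have v: "(\<Sum>j\<in>S. cosh ((r / \<sigma> j)\<^sup>2) - 1) / (card S)\<^sup>2 \<le> 1 / 2" .
  have power: "\<alpha> + 3 / 8 < (p j (r / \<sigma> j) + p j (- (r / \<sigma> j))) / 2" if "j \<in> S" for j
  proof -
    have j: "j \<in> J" "j \<in> {1..n}" "\<sigma> j > 0" using that S \<sigma> by (auto simp: S_def)
    then have "p j (s / \<sigma> j) = reject_prob J \<sigma> (spike J j s) \<Phi>" for s
      unfolding p_def by (intro reject_prob_spike [symmetric] \<Phi>') auto
    moreover have "reject_prob J \<sigma> (spike J j s) \<Phi> > \<alpha> + 3 / 8" if "s \<in> {r, - r}" for s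
      using neg j that by (auto simp: not_le)
    ultimately have "\<alpha> + 3 / 8 < p j (s / \<sigma> j)" if "s \<in> {r, - r}" for s
      using that by metis
    from this [of r] this [of "- r"] show ?thesis by simp
  qed
  have "card S * (\<alpha> + 3 / 8) < (\<Sum>j\<in>S. (p j (r / \<sigma> j) + p j (- (r / \<sigma> j))) / 2)"
    using sum_strict_mono [OF S(1,2) power] by simp
  then have "\<alpha> + 3 / 8 < (\<Sum>j\<in>S. (p j (r / \<sigma> j) + p j (- (r / \<sigma> j))) / 2) / card S"
    using m by (simp add: less_divide_eq mult.commute)
  also have "\<dots> \<le> (1 + 1 / 2) / 4 + \<alpha>"
  proof -
    have gap: "x \<le> (1 + 1 / 2) / 4 + \<alpha>" if "x - y \<le> (1 + w) / 4" "w \<le> 1 / 2" "y \<le> \<alpha>" for x y w :: real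
      using that by simp
    show ?thesis
      using average_power_le [OF S rejection_region_measurable [OF \<Phi>'], of "\<lambda>j. r / \<sigma> j" \<sigma>] v level
      unfolding p_def by (rule gap)
  qed
  finally show False by simp
qed

theorem corollary1:
  fixes J :: "nat set" and \<sigma> :: "nat \<Rightarrow> real" and n k :: nat and \<alpha> \<beta> :: real
  assumes J: "(\<exists>N\<ge>1. J = {1..N} \<and> n \<le> N) \<or> J = {1..}"
    and \<sigma>: "\<forall>j\<in>J. \<sigma> j > 0"
    and n: "n \<ge> 1"
    and \<alpha>: "0 < \<alpha>" "\<alpha> < 1"
    and \<beta>: "0 < \<beta>" "\<beta> < 1 - \<alpha>"
    and \<alpha>\<beta>: "\<alpha> + \<beta> \<le> 0.59"
    and k: "1 \<le> k" "k \<le> n"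
  shows "rho_infty J \<sigma> (sparse_set J k n) \<alpha> \<beta> \<ge> ereal (rho_n_infty \<sigma> n)"
proof -
  have sub: "{1..n} \<subseteq> J" using J by auto
  have "rho_n_infty \<sigma> n \<in> (\<lambda>l. order_stat \<sigma> n (l + 1) * sqrt (ln (1 + real n - real l))) ` {0..n-1}"
    unfolding rho_n_infty_def by (rule Max_in) auto
  then obtain l where "l \<in> {0..n-1}"
    and r: "rho_n_infty \<sigma> n = order_stat \<sigma> n (l + 1) * sqrt (ln (1 + real n - real l))"
    by blast
  then have l: "l < n" using n by auto
  have "rho_n_infty \<sigma> n \<le> \<rho>"
    if \<Phi>: "\<Phi> \<in> level_tests J \<sigma> \<alpha>" and "\<rho> > 0"
      and powerful: "(INF \<theta>\<in>{\<theta> \<in> sparse_set J k n. sup_norm J \<theta> \<ge> \<rho>}. ereal (reject_prob J \<sigma> \<theta> \<Phi>))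
        > ereal (1 - \<beta>)" for \<Phi> \<rho>
  proof (rule ccontr)
    assume less: "\<not> rho_n_infty \<sigma> n \<le> \<rho>"
    obtain j s where j: "j \<in> {1..n}" and s: "s \<in> {rho_n_infty \<sigma> n, - rho_n_infty \<sigma> n}"
      and low: "reject_prob J \<sigma> (spike J j s) \<Phi> \<le> \<alpha> + 3 / 8"
      using ex_spike_power_le [OF sub \<sigma> l \<Phi>] unfolding r by blast
    have "spike J j s \<in> {\<theta> \<in> sparse_set J k n. sup_norm J \<theta> \<ge> \<rho>}"
      using j s less sub k \<open>\<rho> > 0\<close> by (auto simp: spike_in_sparse_set sup_norm_spike)
    then have "ereal (1 - \<beta>) < ereal (reject_prob J \<sigma> (spike J j s) \<Phi>)"
      using powerful by (meson INF_lower less_le_trans)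
    then show False using low \<alpha>\<beta> by simp
  qed
  then show ?thesis
    unfolding rho_infty_def rho_infty_test_def
    by (intro INF_greatest Inf_greatest) auto
qed

end
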